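(* Let $D$ be a digraph on $n$ vertices having positive complexity. Then $\mathbf{0}\in P_D$. Moreover, $\mathbf{0}$ is an interior point of $P_D$ (i.e. lies in the relative interior of $P_D$) if and only if $D$ is strongly connected.
   Context: A digraph $D$ is a finite directed graph on the vertex set $[n]=\{1,\ldots,n\}$, without loops and without isolated vertices (vertices with indegree and outdegree both zero); multiple directed edges are allowed. A directed edge $(i,j)$ has tail $i$ and head $j$. $D$ is strongly connected if it contains a directed path from $i$ to $j$ for every pair of vertices $i,j$. Let $a_{i,j}$ be the number of edges with tail $i$ and head $j$ (so $a_{i,i}=0$), and let $\mathrm{outdeg}(i)=\sum_j a_{i,j}$. The Laplacian matrix of $D$ is $L(D)=O(D)-A(D)$, where $A(D)=(a_{i,j})$ and $O(D)$ is the diagonal matrix with entries $\mathrm{outdeg}(i)$. The Laplacian polytope of $D$ is $P_D=\operatorname{conv}\{\mathbf{v}_1,\ldots,\mathbf{v}_n\}\subset\mathbb{R}^n$, where $\mathbf{v}_i$ is the $i$-th row of $L(D)$. A converging tree is a digraph whose underlying undirected graph is connected and that has one vertex of outdegree zero (its root), all other vertices having outdegree one. A subgraph of $D$ is spanning if its vertex set is $[n]$. The complexity $c(D)$ of $D$ is the total number of spanning converging trees of $D$ (parallel edges are regarded as distinct); $D$ has positive complexity if $c(D)>0$. *)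

theory Defs
  imports "HOL-Analysis.Analysis" "Graph_Theory.Digraph_Component"
begin

text \<open>Arcs have an identity of their own, so parallel arcs are allowed and regarded as distinct.\<close>

locale loopfree_multidigraph = fin_digraph + loopfree_digraph +
  assumes no_isolated: "v \<in> verts G \<Longrightarrow> \<not> (in_degree G v = 0 \<and> out_degree G v = 0)"

text \<open>In the matrices below the vertex set is the whole finite index type, in place of
  \<open>{1, \<dots>, n}\<close>.\<close>

definition adjacency_matrix :: "('n::finite, 'e) pre_digraph \<Rightarrow> real ^ 'n ^ 'n" where
  "adjacency_matrix D = (\<chi> i j. real (card (out_arcs D i \<inter> in_arcs D j)))"

definition outdegree_matrix :: "('n::finite, 'e) pre_digraph \<Rightarrow> real ^ 'n ^ 'n" where
  "outdegree_matrix D = (\<chi> i j. if i = j then real (out_degree D i) else 0)"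

definition laplacian_matrix :: "('n::finite, 'e) pre_digraph \<Rightarrow> real ^ 'n ^ 'n" where
  "laplacian_matrix D = outdegree_matrix D - adjacency_matrix D"

definition laplacian_polytope :: "('n::finite, 'e) pre_digraph \<Rightarrow> (real ^ 'n) set" where
  "laplacian_polytope D = convex hull (rows (laplacian_matrix D))"

text \<open>The qualified name refers to connectedness of the underlying undirected graph; the short
  name is ambiguous with topological connectedness.\<close>

definition converging_tree :: "('a, 'e) pre_digraph \<Rightarrow> bool" where
  "converging_tree T \<longleftrightarrow>
     fin_digraph T \<and> loopfree_digraph T \<and> Digraph_Component.connected T \<and>
     (\<exists>r\<in>verts T. out_degree T r = 0 \<and> (\<forall>v\<in>verts T - {r}. out_degree T v = 1))"

text \<open>A spanning subgraph of \<open>D\<close> shares the tail and head functions of \<open>D\<close>, so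
  it is determined by its arc set and nothing is counted twice.\<close>

definition complexity :: "('a, 'e) pre_digraph \<Rightarrow> nat" where
  "complexity D = card {T. spanning T D \<and> converging_tree T}"

end

theory Submission
  imports Defs
begin

text \<open>
  For \<open>y :: real ^ 'n\<close>, the inner product of \<open>y\<close> with the \<open>i\<close>-th row of the Laplacian is the sum
  of \<open>y\<^sub>i - y\<^sub>j\<close> over the arcs \<open>(i, j)\<close> leaving \<open>i\<close>, so it is nonpositive at a minimum of \<open>y\<close>.
  Hence no hyperplane strictly separates \<open>0\<close> from the polytope, and if \<open>y\<close> is nonnegative on the
  polytope then the set of minima of \<open>y\<close> is closed under out-neighbours. In the strongly connected
  case such a \<open>y\<close> is constant and vanishes on the polytope, so there is no proper supporting
  hyperplane at \<open>0\<close>. Conversely, positive complexity yields a root \<open>r\<close> reachable from everywhere; if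
  \<open>r\<close> does not reach everything, the indicator function of the vertices not reachable from \<open>r\<close> is
  such a supporting hyperplane.
\<close>

text \<open>Induction along an undirected path starting at \<open>r\<close>. An edge pointing back
  towards the known vertex extends its directed path to \<open>r\<close>; an edge pointing away is
  the only way out of that vertex, so the path to \<open>r\<close> already runs through the new
  vertex.\<close>

lemma (in fin_digraph) reachable_out_degree_0_connected:
  assumes conn: "Digraph_Component.connected G"
    and r: "r \<in> verts G" "out_degree G r = 0"
    and out1: "\<And>v. v \<in> verts G - {r} \<Longrightarrow> out_degree G v = 1"
    and v: "v \<in> verts G"
  shows "v \<rightarrow>\<^sup>*\<^bsub>G\<^esub> r"
proof -
  interpret S: pair_wf_digraph "mk_symmetric G" ..
  have "r \<rightarrow>\<^sup>*\<^bsub>mk_symmetric G\<^esub> v"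
    using conn r v by (auto simp: connected_def)
  then show ?thesis
  proof (induct rule: S.reachable_induct)
    case base
    show ?case using r by simp
  next
    case (step x y)
    from step(2) obtain e where e: "e \<in> arcs G"
      and ends: "tail G e = x \<and> head G e = y \<or> tail G e = y \<and> head G e = x"
      by (auto simp: parcs_mk_symmetric)
    from ends show ?case
    proof
      assume xy: "tail G e = x \<and> head G e = y"
      \<comment> \<open>The root has no outgoing arc, so the path from \<open>x\<close> to
        \<open>r\<close> has a first arc \<open>f\<close>, which must be \<open>e\<close>.\<close>
      have "x \<noteq> r"
      proof
        assume "x = r"
        then have "e \<in> out_arcs G r" using e xy by simp
        moreover have "out_arcs G r = {}"
          using r(2) finite_out_arcs[of r] unfolding out_degree_def by simp
        ultimately show False by simp
      qed
      with step(3) obtain w where w: "x \<rightarrow>\<^bsub>G\<^esub> w" "w \<rightarrow>\<^sup>*\<^bsub>G\<^esub> r"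
        by (cases rule: converse_reachable_cases) auto
      then obtain f where f: "f \<in> out_arcs G x" "head G f = w" by auto
      have "card (out_arcs G x) = 1"
        using out1[of x] \<open>x \<noteq> r\<close> adj_in_verts(1)[OF w(1)] by (simp add: out_degree_def)
      then obtain g where "out_arcs G x = {g}" by (rule card_1_singletonE)
      moreover have "e \<in> out_arcs G x" using e xy by simp
      ultimately have "e = f" using f(1) by simp
      with xy f(2) w(2) show ?thesis by simp
    next
      assume "tail G e = y \<and> head G e = x"
      then have "y \<rightarrow>\<^bsub>G\<^esub> x" using e by (auto simp: arcs_ends_conv)
      then show ?thesis using step(3) by (rule adj_reachable_trans)
    qed
  qed
qed

lemma positive_complexity_reachable:
  assumes "complexity D > 0"
  obtains r where "r \<in> verts D" "\<And>v. v \<in> verts D \<Longrightarrow> v \<rightarrow>\<^sup>*\<^bsub>D\<^esub> r"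
proof -
  have "{T. spanning T D \<and> converging_tree T} \<noteq> {}"
    using assms unfolding complexity_def by (metis card.empty less_irrefl)
  then obtain T where sp: "spanning T D" and tree: "converging_tree T" by blast
  from tree obtain r where r: "r \<in> verts T" "out_degree T r = 0"
      "\<forall>v\<in>verts T - {r}. out_degree T v = 1"
    and fin: "fin_digraph T" and conn: "Digraph_Component.connected T"
    unfolding converging_tree_def by blast
  have sub: "subgraph T D" and verts: "verts D = verts T"
    using sp by (auto simp: spanning_def)
  show thesis
  proof
    show "r \<in> verts D" using r verts by simp
    fix v assume "v \<in> verts D"
    then have "v \<rightarrow>\<^sup>*\<^bsub>T\<^esub> r"
      using fin_digraph.reachable_out_degree_0_connected[OF fin conn r(1,2)] r(3) verts by blast
    then show "v \<rightarrow>\<^sup>*\<^bsub>D\<^esub> r" using sub by (rule pre_digraph.reachable_mono)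
  qed
qed

text \<open>Grouping arcs by head turns the multiplicities in the adjacency matrix into a sum over
  individual arcs.\<close>

lemma sum_out_arcs_by_head:
  fixes G :: "('n::finite, 'e) pre_digraph" and f :: "'n \<Rightarrow> real"
  assumes "fin_digraph G"
  shows "(\<Sum>e\<in>out_arcs G i. f (head G e)) = (\<Sum>j\<in>UNIV. card (out_arcs G i \<inter> in_arcs G j) * f j)"
proof -
  interpret fin_digraph G by fact
  have "out_arcs G i \<inter> in_arcs G j = {e \<in> out_arcs G i. head G e = j}" for j
    by auto
  then have "(\<Sum>j\<in>UNIV. card (out_arcs G i \<inter> in_arcs G j) * f j)
      = (\<Sum>j\<in>UNIV. \<Sum>e\<in>{e \<in> out_arcs G i. head G e = j}. f (head G e))"
    by simp
  also have "\<dots> = (\<Sum>e\<in>out_arcs G i. f (head G e))"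
    by (rule sum.group) auto
  finally show ?thesis ..
qed

lemma inner_row_laplacian:
  fixes D :: "('n::finite, 'e) pre_digraph"
  assumes "fin_digraph D"
  shows "y \<bullet> row i (laplacian_matrix D) = (\<Sum>e\<in>out_arcs D i. y $ i - y $ head D e)"
proof -
  interpret fin_digraph D by fact
  have "y \<bullet> row i (laplacian_matrix D)
      = (\<Sum>j\<in>UNIV. (if i = j then y $ j * out_degree D i else 0))
        - (\<Sum>j\<in>UNIV. card (out_arcs D i \<inter> in_arcs D j) * y $ j)"
    unfolding inner_vec_def row_def laplacian_matrix_def outdegree_matrix_def adjacency_matrix_def
      sum_subtractf[symmetric]
    by (intro sum.cong) (auto simp: algebra_simps)
  also have "\<dots> = (\<Sum>e\<in>out_arcs D i. y $ i - y $ head D e)"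
    by (simp add: sum_subtractf out_degree_def flip: sum_out_arcs_by_head[OF assms])
  finally show ?thesis .
qed

lemma laplacian_polytope_nonempty: "laplacian_polytope D \<noteq> {}"
  unfolding laplacian_polytope_def rows_def by auto

lemma convex_laplacian_polytope: "convex (laplacian_polytope D)"
  unfolding laplacian_polytope_def by (rule convex_convex_hull)

lemma compact_laplacian_polytope: "compact (laplacian_polytope D)"
  unfolding laplacian_polytope_def rows_def
  by (intro finite_imp_compact_convex_hull) (simp add: full_SetCompr_eq)

lemma row_in_laplacian_polytope: "row i (laplacian_matrix D) \<in> laplacian_polytope D"
  unfolding laplacian_polytope_def rows_def by (rule hull_inc) blast

text \<open>A halfspace is convex, so it contains the hull as soon as it contains the
  generators.\<close>

lemma inner_laplacian_polytope_nonneg: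
  assumes "\<And>i. 0 \<le> y \<bullet> row i (laplacian_matrix D)" and "x \<in> laplacian_polytope D"
  shows "0 \<le> y \<bullet> x"
proof -
  have "laplacian_polytope D \<subseteq> {x. y \<bullet> x \<ge> 0}"
    unfolding laplacian_polytope_def
    by (intro hull_minimal convex_halfspace_ge) (use assms(1) in \<open>auto simp: rows_def\<close>)
  with assms(2) show ?thesis by auto
qed

lemma inner_laplacian_polytope_eq_0:
  assumes "\<And>i. y \<bullet> row i (laplacian_matrix D) = 0" and "x \<in> laplacian_polytope D"
  shows "y \<bullet> x = 0"
  using inner_laplacian_polytope_nonneg[of y D x] inner_laplacian_polytope_nonneg[of "- y" D x] assms
  by simp

lemma ex_minimal_component:
  fixes y :: "real ^ 'n"
  obtains m where "\<And>j. y $ m \<le> y $ j"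
  using arg_min_if_finite(2)[of "UNIV :: 'n set" "\<lambda>i. y $ i"]
  by (metis UNIV_I UNIV_not_empty finite linorder_not_le)

lemma zero_in_laplacian_polytope:
  fixes D :: "('n::finite, 'e) pre_digraph"
  assumes "fin_digraph D"
  shows "0 \<in> laplacian_polytope D"
proof (rule ccontr)
  assume "0 \<notin> laplacian_polytope D"
  then obtain a b where ab: "0 < b" "\<And>x. x \<in> laplacian_polytope D \<Longrightarrow> b < a \<bullet> x"
    using separating_hyperplane_closed_0[OF convex_laplacian_polytope
        compact_imp_closed[OF compact_laplacian_polytope], of D] by blast
  obtain m where "\<And>j. a $ m \<le> a $ j" using ex_minimal_component[of a] by blast
  \<comment> \<open>Each summand \<open>a $ m - a $ head D e\<close> is nonpositive by minimality of
    \<open>a $ m\<close>.\<close>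
  then have "a \<bullet> row m (laplacian_matrix D) \<le> 0"
    unfolding inner_row_laplacian[OF assms] by (intro sum_nonpos) simp
  moreover have "b < a \<bullet> row m (laplacian_matrix D)"
    by (intro ab row_in_laplacian_polytope)
  ultimately show False using ab(1) by simp
qed

lemma zero_in_rel_interior_if_strongly_connected:
  fixes D :: "('n::finite, 'e) pre_digraph"
  assumes fin: "fin_digraph D" and verts: "verts D = UNIV" and sc: "strongly_connected D"
  shows "0 \<in> rel_interior (laplacian_polytope D)"
proof (rule ccontr)
  let ?P = "laplacian_polytope D"
  interpret fin_digraph D by fact
  assume "0 \<notin> rel_interior ?P"
  \<comment> \<open>As \<open>0\<close> lies in \<open>?P\<close> but outside its relative interior,
    there is a supporting hyperplane through \<open>0\<close> that does not contain all of
    \<open>?P\<close>; hence the strict inequality in \<open>gr\<close>.\<close>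
  then obtain a where ge: "\<And>x. x \<in> ?P \<Longrightarrow> 0 \<le> a \<bullet> x"
    and gr: "\<And>x. x \<in> rel_interior ?P \<Longrightarrow> 0 < a \<bullet> x"
    using supporting_hyperplane_rel_boundary[OF convex_laplacian_polytope
        zero_in_laplacian_polytope[OF fin]] by (metis inner_zero_right)
  obtain m where m: "\<And>j. a $ m \<le> a $ j" using ex_minimal_component[of a] by blast
  have const: "a $ v = a $ m" for v
  proof -
    have "m \<rightarrow>\<^sup>*\<^bsub>D\<^esub> v" using sc verts by (auto simp: strongly_connected_def)
    then show ?thesis
    proof (induct rule: reachable_induct)
      case (step x z)
      then obtain e where e: "e \<in> out_arcs D x" "head D e = z" by auto
      \<comment> \<open>By induction \<open>x\<close> is itself a minimum. The differences are
        therefore nonnegative with nonpositive sum, so each vanishes and \<open>z\<close> is a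
        minimum too.\<close>
      have nonneg: "0 \<le> a $ head D e' - a $ x" for e' using m step(3) by simp
      have "0 \<le> a \<bullet> row x (laplacian_matrix D)" by (intro ge row_in_laplacian_polytope)
      then have "(\<Sum>e\<in>out_arcs D x. a $ head D e - a $ x) \<le> 0"
        unfolding inner_row_laplacian[OF fin] by (simp add: sum_subtractf)
      then have "(\<Sum>e\<in>out_arcs D x. a $ head D e - a $ x) = 0"
        using nonneg by (intro antisym sum_nonneg) auto
      then have "a $ head D e - a $ x = 0"
        using nonneg e(1) finite_out_arcs by (subst (asm) sum_nonneg_eq_0_iff) auto
      with e(2) step(3) show ?case by simp
    qed simp
  qed
  have "a \<bullet> row i (laplacian_matrix D) = 0" for i
    unfolding inner_row_laplacian[OF fin] by (simp add: const[of i] const[of "head D _"])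
  then have "a \<bullet> x = 0" if "x \<in> ?P" for x
    using that by (rule inner_laplacian_polytope_eq_0)
  moreover obtain x where "x \<in> rel_interior ?P"
    using rel_interior_eq_empty[OF convex_laplacian_polytope] laplacian_polytope_nonempty by blast
  ultimately show False using gr[of x] rel_interior_subset[of ?P] by force
qed

lemma strongly_connected_if_zero_in_rel_interior:
  fixes D :: "('n::finite, 'e) pre_digraph"
  assumes fin: "fin_digraph D" and verts: "verts D = UNIV"
    and root: "\<And>v. v \<rightarrow>\<^sup>*\<^bsub>D\<^esub> r"
    and int: "0 \<in> rel_interior (laplacian_polytope D)"
  shows "strongly_connected D"
proof -
  let ?P = "laplacian_polytope D"
  interpret fin_digraph D by fact
  define y :: "real ^ 'n" where "y = (\<chi> i. if r \<rightarrow>\<^sup>*\<^bsub>D\<^esub> i then 0 else 1)"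
  have nonneg: "0 \<le> y $ i - y $ head D e" if "e \<in> out_arcs D i" for i e
  proof -
    have "i \<rightarrow>\<^bsub>D\<^esub> head D e" using that by (auto simp: arcs_ends_conv)
    then show ?thesis using reachable_adj_trans by (auto simp: y_def)
  qed
  have rows: "0 \<le> y \<bullet> row i (laplacian_matrix D)" for i
    unfolding inner_row_laplacian[OF fin] using nonneg by (rule sum_nonneg)
  have zero: "y \<bullet> row i (laplacian_matrix D) = 0" for i
  proof -
    \<comment> \<open>From a relative interior point, the segment from row \<open>i\<close> to
      \<open>0\<close> extends beyond \<open>0\<close> inside \<open>?P\<close>. This yields a
      negative multiple of the row on which \<open>y\<close> is still nonnegative.\<close>
    obtain e where "e > 1" "(1 - e) *\<^sub>R row i (laplacian_matrix D) + e *\<^sub>R 0 \<in> ?P"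
      using int convex_rel_interior_iff[OF convex_laplacian_polytope laplacian_polytope_nonempty]
        row_in_laplacian_polytope by blast
    then have "0 \<le> (1 - e) * (y \<bullet> row i (laplacian_matrix D))"
      using inner_laplacian_polytope_nonneg[of y D, OF rows] by fastforce
    with \<open>e > 1\<close> rows[of i] show ?thesis
      by (simp add: zero_le_mult_iff)
  qed
  have reach: "r \<rightarrow>\<^sup>*\<^bsub>D\<^esub> v" for v
    using root[of v]
  \<comment> \<open>Backwards along a path from \<open>v\<close> to \<open>r\<close>: the vanishing
    sum of nonnegative terms forces \<open>y\<close> to agree at both ends of each arc, so
    \<open>y\<close> stays \<open>0\<close>, which means reachable from \<open>r\<close>.\<close>
  proof (induct rule: converse_reachable_induct)
    case (step x z)
    then obtain e where e: "e \<in> out_arcs D x" "head D e = z" by auto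
    have "y $ x - y $ head D e = 0"
      using zero[of x] e(1) nonneg finite_out_arcs
        sum_nonneg_eq_0_iff[of "out_arcs D x" "\<lambda>e. y $ x - y $ head D e"]
      unfolding inner_row_laplacian[OF fin] by blast
    with e(2) step(3) show ?case by (auto simp: y_def split: if_splits)
  qed simp
  show ?thesis
    using root reach reachable_trans verts by (intro strongly_connectedI) blast+
qed

theorem corollary6:
  fixes D :: "('n::finite, 'e) pre_digraph"
  assumes "loopfree_multidigraph D"
    and "verts D = UNIV"
    and "complexity D > 0"
  shows "0 \<in> laplacian_polytope D \<and>
    (0 \<in> rel_interior (laplacian_polytope D) \<longleftrightarrow> strongly_connected D)"
proof -
  interpret loopfree_multidigraph D by fact
  obtain r where "\<And>v. v \<rightarrow>\<^sup>*\<^bsub>D\<^esub> r"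
    using positive_complexity_reachable[OF assms(3)] assms(2) by auto
  then show ?thesis
    using zero_in_laplacian_polytope zero_in_rel_interior_if_strongly_connected
      strongly_connected_if_zero_in_rel_interior fin_digraph assms(2) by metis
qed

end
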